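(* Let $n\ge1$, $\tau\in[0,1]$, and $\tilde g_1,\tilde g_2,\tilde g_3\in\mathbb{R}^n$. Consider the three-objective ($K=3$) PCD quadratic program in the case where both constraints are active, so that $\tilde d^*=\tilde g_1+\mu_2^*\tilde g_2+\mu_3^*\tilde g_3$ where $(\mu_2^*,\mu_3^* )$ satisfies the $2\times2$ Gram system $$\begin{pmatrix}\|\tilde g_2\|^2&\tilde g_2^\top\tilde g_3\\ \tilde g_2^\top\tilde g_3&\|\tilde g_3\|^2\end{pmatrix}\begin{pmatrix}\mu_2\\ \mu_3\end{pmatrix}=\begin{pmatrix}\tau\|\tilde g_2\|^2-\tilde g_2^\top\tilde g_1\\ \tau\|\tilde g_3\|^2-\tilde g_3^\top\tilde g_1\end{pmatrix}.$$ Let $\Delta=\|\tilde g_2\|^2\|\tilde g_3\|^2-(\tilde g_2^\top\tilde g_3)^2$, which equals $\|\tilde g_2\|^2\|\tilde g_3\|^2\sin^2\theta_{23}$ when $\tilde g_2,\tilde g_3$ are nonzero and $\theta_{23}$ is the angle between them. The system is uniquely solvable if and only if $\tilde g_2,\tilde g_3$ are not collinear, and in that case $$\mu_2^*=\frac{\|\tilde g_3\|^2(\tau\|\tilde g_2\|^2-\tilde g_2^\top\tilde g_1)-(\tilde g_2^\top\tilde g_3)(\tau\|\tilde g_3\|^2-\tilde g_3^\top\tilde g_1)}{\Delta},$$ $$\mu_3^*=\frac{\|\tilde g_2\|^2(\tau\|\tilde g_3\|^2-\tilde g_3^\top\tilde g_1)-(\tilde g_2^\top\tilde g_3)(\tau\|\tilde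 g_2\|^2-\tilde g_2^\top\tilde g_1)}{\Delta}.$$
   Context: $\|\cdot\|$ is the Euclidean norm. For $K=3$ the PCD direction is $\tilde d^*=\arg\min\{\|d-\tilde g_1\|^2: d\in\mathbb{R}^n,\ \tilde g_j^\top d\ge\tau\|\tilde g_j\|^2,\ j=2,3\}$. By the KKT conditions $\tilde d^*=\tilde g_1+\mu_2^*\tilde g_2+\mu_3^*\tilde g_3$ with multipliers $\mu_j^*\ge0$; both constraints being active means $\tilde g_j^\top\tilde d^*=\tau\|\tilde g_j\|^2$ for $j=2,3$, and substituting the expression for $\tilde d^*$ into these two equalities gives the Gram system. Two vectors are collinear if they are linearly dependent (in particular if one of them is zero). *)

theory Defs
  imports "HOL-Analysis.Analysis"
begin

definition pcd_feasible ::
    "real \<Rightarrow> real ^ 'n \<Rightarrow> real ^ 'n \<Rightarrow> real ^ 'n \<Rightarrow> bool" where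
  "pcd_feasible \<tau> g2 g3 d \<longleftrightarrow>
     g2 \<bullet> d \<ge> \<tau> * (norm g2)\<^sup>2 \<and> g3 \<bullet> d \<ge> \<tau> * (norm g3)\<^sup>2"

definition is_pcd_direction ::
    "real \<Rightarrow> real ^ 'n \<Rightarrow> real ^ 'n \<Rightarrow> real ^ 'n \<Rightarrow> real ^ 'n \<Rightarrow> bool" where
  "is_pcd_direction \<tau> g1 g2 g3 d \<longleftrightarrow>
     is_arg_min (\<lambda>d. (norm (d - g1))\<^sup>2) (pcd_feasible \<tau> g2 g3) d"

definition pcd_constraints_active ::
    "real \<Rightarrow> real ^ 'n \<Rightarrow> real ^ 'n \<Rightarrow> real ^ 'n \<Rightarrow> bool" where
  "pcd_constraints_active \<tau> g2 g3 d \<longleftrightarrow>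
     g2 \<bullet> d = \<tau> * (norm g2)\<^sup>2 \<and> g3 \<bullet> d = \<tau> * (norm g3)\<^sup>2"

text \<open>The pair of multipliers of the second and third objective is a vector in the plane:
  component 1 belongs to \<open>g2\<close>, component 2 to \<open>g3\<close>.  Complementary slackness is not listed,
  because the multipliers are only used when both constraints are active.\<close>

definition is_pcd_multiplier ::
    "real ^ 'n \<Rightarrow> real ^ 'n \<Rightarrow> real ^ 'n \<Rightarrow> real ^ 'n \<Rightarrow> real ^ 2 \<Rightarrow> bool" where
  "is_pcd_multiplier g1 g2 g3 d \<mu> \<longleftrightarrow>
     \<mu> $ 1 \<ge> 0 \<and> \<mu> $ 2 \<ge> 0 \<and> d = g1 + (\<mu> $ 1) *\<^sub>R g2 + (\<mu> $ 2) *\<^sub>R g3"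

definition gram_matrix :: "real ^ 'n \<Rightarrow> real ^ 'n \<Rightarrow> real ^ 2 ^ 2" where
  "gram_matrix g2 g3 =
     vector [vector [(norm g2)\<^sup>2, g2 \<bullet> g3],
             vector [g2 \<bullet> g3, (norm g3)\<^sup>2]]"

definition gram_rhs ::
    "real \<Rightarrow> real ^ 'n \<Rightarrow> real ^ 'n \<Rightarrow> real ^ 'n \<Rightarrow> real ^ 2" where
  "gram_rhs \<tau> g1 g2 g3 =
     vector [\<tau> * (norm g2)\<^sup>2 - g2 \<bullet> g1, \<tau> * (norm g3)\<^sup>2 - g3 \<bullet> g1]"

definition gram_delta :: "real ^ 'n \<Rightarrow> real ^ 'n \<Rightarrow> real" where
  "gram_delta g2 g3 = (norm g2)\<^sup>2 * (norm g3)\<^sup>2 - (g2 \<bullet> g3)\<^sup>2"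

text \<open>Only meaningful for nonzero vectors.\<close>

definition vec_angle :: "real ^ 'n \<Rightarrow> real ^ 'n \<Rightarrow> real" where
  "vec_angle u v = arccos (u \<bullet> v / (norm u * norm v))"

text \<open>Linear dependence of the pair \<open>u\<close>, \<open>v\<close> as a family.  The library predicate
  \<open>dependent {u, v}\<close> is not the same: for \<open>u = v \<noteq> 0\<close> the set collapses to an independent
  singleton, although the pair is linearly dependent.\<close>

definition collinear_vectors :: "real ^ 'n \<Rightarrow> real ^ 'n \<Rightarrow> bool" where
  "collinear_vectors u v \<longleftrightarrow>
     (\<exists>a b :: real. (a \<noteq> 0 \<or> b \<noteq> 0) \<and> a *\<^sub>R u + b *\<^sub>R v = 0)"

end

theory Submission
  imports Defs
begin

text \<open>At a minimizer where both constraints are active, no direction \<open>w\<close> with nonnegative inner product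
  with \<open>g2\<close> and \<open>g3\<close> can decrease the distance to \<open>g1\<close>.  Farkas' lemma turns this into membership of
  \<open>d - g1\<close> in the cone generated by \<open>g2\<close> and \<open>g3\<close>, which is the existence of KKT multipliers without
  any constraint qualification.  The rest is linear algebra of the Gram matrix, whose determinant
  vanishes exactly in the equality case of Cauchy--Schwarz.\<close>

text \<open>The cone generated by a finite set is closed, so a point outside it is strictly
  separated from it by some \<open>w\<close>. The cone contains 0 and is stable under scaling, so
  \<open>w\<close> is nonnegative on \<open>S\<close> yet negative at \<open>v\<close>.\<close>

lemma farkas:
  fixes v :: "'a::euclidean_space"
  assumes "finite S" and dual: "\<And>w. (\<And>x. x \<in> S \<Longrightarrow> 0 \<le> x \<bullet> w) \<Longrightarrow> 0 \<le> v \<bullet> w"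
  shows "v \<in> convex_cone hull S"
proof (rule ccontr)
  assume "v \<notin> convex_cone hull S"
  then obtain w b where wv: "w \<bullet> v < b" and wC: "\<And>x. x \<in> convex_cone hull S \<Longrightarrow> b < w \<bullet> x"
    using separating_hyperplane_closed_point[of "convex_cone hull S" v]
      closed_convex_cone_hull[OF \<open>finite S\<close>] convex_convex_cone_hull by metis
  have b: "b < 0"
    using wC[OF convex_cone_hull_contains_0] by simp
  have "0 \<le> x \<bullet> w" if "x \<in> S" for x
  proof (rule ccontr)
    assume neg: "\<not> 0 \<le> x \<bullet> w"
    \<comment> \<open>Both \<open>b\<close> and \<open>x \<bullet> w\<close> are negative, so the
      factor is positive; it places the multiple of \<open>x\<close> exactly on the separating
      hyperplane, which the cone must miss.\<close>
    then have "(b / (x \<bullet> w)) *\<^sub>R x \<in> convex_cone hull S"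
      using b that by (intro convex_cone_hull_mul hull_inc) (auto simp: divide_nonpos_neg)
    from wC[OF this] show False
      using neg by (simp add: inner_commute)
  qed
  then have "0 \<le> v \<bullet> w"
    by (rule dual)
  with wv b show False
    by (simp add: inner_commute)
qed

text \<open>Turns cone membership into two explicit coefficients, the future multipliers. The
  right-hand set is itself a convex cone through \<open>a\<close> and \<open>b\<close>, hence
  contains the smallest one.\<close>

lemma convex_cone_hull_2_subset:
  "convex_cone hull {a, b} \<subseteq> {s *\<^sub>R a + t *\<^sub>R b | s t. 0 \<le> s \<and> 0 \<le> t}"
proof (rule hull_minimal)
  let ?C = "{s *\<^sub>R a + t *\<^sub>R b | s t. 0 \<le> s \<and> 0 \<le> t}"
  have "\<exists>s t. a = s *\<^sub>R a + t *\<^sub>R b \<and> 0 \<le> s \<and> 0 \<le> t"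
    by (rule exI[of _ 1], rule exI[of _ 0]) simp
  moreover have "\<exists>s t. b = s *\<^sub>R a + t *\<^sub>R b \<and> 0 \<le> s \<and> 0 \<le> t"
    by (rule exI[of _ 0], rule exI[of _ 1]) simp
  ultimately show "{a, b} \<subseteq> ?C"
    by blast
  show "convex_cone ?C"
    unfolding convex_cone_iff
  proof (intro conjI ballI allI impI)
    show "0 \<in> ?C"
      by (auto intro!: exI[of _ 0])
  next
    fix x y assume "x \<in> ?C" "y \<in> ?C"
    then obtain s t s' t' where "x = s *\<^sub>R a + t *\<^sub>R b" "y = s' *\<^sub>R a + t' *\<^sub>R b"
      "0 \<le> s" "0 \<le> t" "0 \<le> s'" "0 \<le> t'"
      by blast
    then have "x + y = (s + s') *\<^sub>R a + (t + t') *\<^sub>R b" "0 \<le> s + s'" "0 \<le> t + t'"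
      by (simp_all add: algebra_simps)
    then show "x + y \<in> ?C"
      by blast
  next
    fix x and c :: real assume "x \<in> ?C" "0 \<le> c"
    then obtain s t where "x = s *\<^sub>R a + t *\<^sub>R b" "0 \<le> s" "0 \<le> t"
      by blast
    with \<open>0 \<le> c\<close> have "c *\<^sub>R x = (c * s) *\<^sub>R a + (c * t) *\<^sub>R b" "0 \<le> c * s" "0 \<le> c * t"
      by (simp_all add: algebra_simps)
    then show "c *\<^sub>R x \<in> ?C"
      by blast
  qed
qed

text \<open>First-order optimality: since every constraint is tight at \<open>d\<close>, moving
  along a \<open>w\<close> that is nonnegative on \<open>S\<close> stays feasible. Such a move
  cannot reduce the distance to \<open>p\<close>, which is the dual condition in
  \<open>farkas\<close>.\<close>

lemma closest_point_halfspaces_normal_cone: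
  fixes d p :: "'a::euclidean_space"
  assumes "finite S"
    and active: "\<And>g. g \<in> S \<Longrightarrow> g \<bullet> d = c g"
    and min: "\<And>y. (\<And>g. g \<in> S \<Longrightarrow> c g \<le> g \<bullet> y) \<Longrightarrow> norm (d - p) \<le> norm (y - p)"
  shows "d - p \<in> convex_cone hull S"
proof (rule farkas[OF \<open>finite S\<close>], rule ccontr)
  fix w assume w: "\<And>x. x \<in> S \<Longrightarrow> 0 \<le> x \<bullet> w" and "\<not> 0 \<le> (d - p) \<bullet> w"
  then have neg: "(d - p) \<bullet> w < 0"
    by simp
  then have ww: "0 < w \<bullet> w"
    by auto
  \<comment> \<open>This step length minimizes the quadratic
    \<open>norm (d - p + t *\<^sub>R w)\<close> squared in \<open>t\<close>; there the squared
    distance changes by \<open>t * ((d - p) \<bullet> w)\<close>.\<close>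
  define t where "t = - ((d - p) \<bullet> w) / (w \<bullet> w)"
  have "0 < t"
    using neg ww by (simp add: t_def field_simps)
  then have "norm (d - p) \<le> norm (d + t *\<^sub>R w - p)"
    using w active by (intro min) (simp add: inner_add_right)
  then have "(d - p) \<bullet> (d - p) \<le> (d - p + t *\<^sub>R w) \<bullet> (d - p + t *\<^sub>R w)"
    by (simp add: norm_le algebra_simps)
  also have "\<dots> = (d - p) \<bullet> (d - p) + t * (2 * ((d - p) \<bullet> w) + t * (w \<bullet> w))"
    by (simp only: inner_add_left inner_add_right inner_scaleR_left inner_scaleR_right
        inner_commute[of w "d - p"]) algebra
  also have "t * (w \<bullet> w) = - ((d - p) \<bullet> w)"
    using ww by (simp add: t_def)
  finally have "0 \<le> t * ((d - p) \<bullet> w)"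
    by simp
  with \<open>0 < t\<close> neg show False
    by (simp add: zero_le_mult_iff)
qed

lemma pcd_multiplier_exists:
  assumes "is_pcd_direction \<tau> g1 g2 g3 d" and "pcd_constraints_active \<tau> g2 g3 d"
  shows "\<exists>\<mu>. is_pcd_multiplier g1 g2 g3 d \<mu>"
proof -
  have "d - g1 \<in> convex_cone hull {g2, g3}"
  \<comment> \<open>The bound is a function of the vector alone, so the case \<open>g2 = g3\<close>,
    where the set collapses to a singleton, needs no separate treatment.\<close>
  proof (rule closest_point_halfspaces_normal_cone[where c = "\<lambda>g. \<tau> * (norm g)\<^sup>2"])
    fix y assume "\<And>g. g \<in> {g2, g3} \<Longrightarrow> \<tau> * (norm g)\<^sup>2 \<le> g \<bullet> y"
    then have "pcd_feasible \<tau> g2 g3 y"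
      by (simp add: pcd_feasible_def)
    then have "(norm (d - g1))\<^sup>2 \<le> (norm (y - g1))\<^sup>2"
      using assms(1) by (simp add: is_pcd_direction_def is_arg_min_linorder)
    then show "norm (d - g1) \<le> norm (y - g1)"
      by simp
  qed (use assms(2) in \<open>auto simp: pcd_constraints_active_def\<close>)
  then obtain s t where "d - g1 = s *\<^sub>R g2 + t *\<^sub>R g3" "0 \<le> s" "0 \<le> t"
    using convex_cone_hull_2_subset by blast
  then have "is_pcd_multiplier g1 g2 g3 d (vector [s, t])"
    by (simp add: is_pcd_multiplier_def algebra_simps)
  then show ?thesis ..
qed

text \<open>Serves twice: with \<open>d - g1\<close> as the combination it yields the Gram system,
  and with a vanishing combination it yields a kernel vector.\<close>

lemma gram_matrix_mult_eq_iff: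
  "gram_matrix g2 g3 *v \<mu> = vector [p, q] \<longleftrightarrow>
     g2 \<bullet> (\<mu> $ 1 *\<^sub>R g2 + \<mu> $ 2 *\<^sub>R g3) = p \<and> g3 \<bullet> (\<mu> $ 1 *\<^sub>R g2 + \<mu> $ 2 *\<^sub>R g3) = q"
  by (simp add: gram_matrix_def vec_eq_iff forall_2 matrix_vector_mult_def sum_2
      inner_add_right power2_norm_eq_inner inner_commute mult.commute)

lemma pcd_multiplier_gram:
  assumes "pcd_constraints_active \<tau> g2 g3 d" and "is_pcd_multiplier g1 g2 g3 d \<mu>"
  shows "gram_matrix g2 g3 *v \<mu> = gram_rhs \<tau> g1 g2 g3"
proof -
  have "\<mu> $ 1 *\<^sub>R g2 + \<mu> $ 2 *\<^sub>R g3 = d - g1"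
    using assms(2) by (simp add: is_pcd_multiplier_def)
  then show ?thesis
    using assms(1)
    by (simp only: gram_rhs_def gram_matrix_mult_eq_iff pcd_constraints_active_def inner_diff_right)
qed

text \<open>Cauchy-Schwarz puts the cosine \<open>r\<close> in the domain of \<open>arccos\<close>,
  where the squared sine is \<open>1 - r\<^sup>2\<close>.\<close>

lemma gram_delta_eq_sin_angle:
  assumes "u \<noteq> 0" "v \<noteq> 0"
  shows "gram_delta u v = (norm u)\<^sup>2 * (norm v)\<^sup>2 * (sin (vec_angle u v))\<^sup>2"
proof -
  define r where "r = u \<bullet> v / (norm u * norm v)"
  have r: "\<bar>r\<bar> \<le> 1"
    using assms Cauchy_Schwarz_ineq2[of u v] by (simp add: r_def abs_mult divide_le_eq)
  then have "(sin (vec_angle u v))\<^sup>2 = 1 - r\<^sup>2"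
    by (simp add: vec_angle_def sin_arccos_abs abs_square_le_1 flip: r_def)
  moreover have "u \<bullet> v = norm u * norm v * r"
    using assms by (simp add: r_def)
  ultimately show ?thesis
    by (simp add: gram_delta_def power_mult_distrib right_diff_distrib)
qed

lemma det_gram_matrix: "det (gram_matrix u v) = gram_delta u v"
  by (simp add: det_2 gram_matrix_def gram_delta_def power2_eq_square)

lemma collinear_if_gram_delta_eq_0:
  assumes "gram_delta u v = 0"
  shows "collinear_vectors u v"
proof -
  have "\<bar>u \<bullet> v\<bar>\<^sup>2 = (norm u * norm v)\<^sup>2"
    using assms by (simp add: gram_delta_def power_mult_distrib)
  then have "\<bar>u \<bullet> v\<bar> = norm u * norm v"
    by (subst (asm) power2_eq_iff_nonneg) simp_all
  \<comment> \<open>Equality in Cauchy-Schwarz means that 0, \<open>u\<close> and \<open>v\<close>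
    lie on one affine line; each case below supplies a nontrivial dependence relation.\<close>
  then consider "u = 0" | "v = 0" | c where "v = c *\<^sub>R u"
    unfolding norm_cauchy_schwarz_equal collinear_lemma by blast
  then show ?thesis
  proof cases
    case 1
    then have "1 *\<^sub>R u + 0 *\<^sub>R v = 0" by simp
    then show ?thesis
      unfolding collinear_vectors_def using zero_neq_one by metis
  next
    case 2
    then have "0 *\<^sub>R u + 1 *\<^sub>R v = 0" by simp
    then show ?thesis
      unfolding collinear_vectors_def using zero_neq_one by metis
  next
    case 3
    then have "(- c) *\<^sub>R u + 1 *\<^sub>R v = 0" by simp
    then show ?thesis
      unfolding collinear_vectors_def using zero_neq_one by metis
  qed
qed

text \<open>The coefficients of a dependence relation form a nonzero kernel vector, and adding it to
  a solution produces a second one.\<close>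

lemma gram_unique_imp_not_collinear:
  assumes "\<exists>!\<mu>. gram_matrix u v *v \<mu> = b"
  shows "\<not> collinear_vectors u v"
proof
  assume "collinear_vectors u v"
  then obtain s t :: real where st: "s \<noteq> 0 \<or> t \<noteq> 0" "s *\<^sub>R u + t *\<^sub>R v = 0"
    unfolding collinear_vectors_def by blast
  define \<nu> :: "real ^ 2" where "\<nu> = vector [s, t]"
  have "gram_matrix u v *v \<nu> = vector [0, 0]"
    using st(2) by (simp only: gram_matrix_mult_eq_iff) (simp add: \<nu>_def)
  also have "vector [0, 0] = (0 :: real ^ 2)"
    by (simp add: vec_eq_iff forall_2)
  finally have ker: "gram_matrix u v *v \<nu> = 0" .
  obtain \<mu> where "gram_matrix u v *v \<mu> = b"
    using assms by blast
  then have "gram_matrix u v *v (\<mu> + \<nu>) = b"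
    using ker by (simp add: matrix_vector_right_distrib)
  with assms \<open>gram_matrix u v *v \<mu> = b\<close> have "\<mu> + \<nu> = \<mu>"
    by blast
  then have "\<nu> = 0" by simp
  then have "\<nu> $ 1 = 0" "\<nu> $ 2 = 0" by simp_all
  then show False
    using st(1) by (simp add: \<nu>_def)
qed

text \<open>Cramer's rule. As an equivalence it provides existence, uniqueness and the closed
  formulas at once.\<close>

lemma gram_solution:
  assumes "gram_delta u v \<noteq> 0"
  shows "gram_matrix u v *v \<mu> = vector [p, q] \<longleftrightarrow>
    \<mu> = vector [((norm v)\<^sup>2 * p - (u \<bullet> v) * q) / gram_delta u v,
                ((norm u)\<^sup>2 * q - (u \<bullet> v) * p) / gram_delta u v]"
proof -
  have "det (gram_matrix u v) \<noteq> 0"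
    using assms by (simp add: det_gram_matrix)
  from cramer[OF this, of \<mu> "vector [p, q]"] show ?thesis
    unfolding det_gram_matrix
    by (simp add: vec_eq_iff forall_2 det_2 gram_matrix_def mult.commute)
qed

theorem corollaryB4:
  fixes \<tau> :: real and g1 g2 g3 d :: "real ^ 'n"
  assumes "0 \<le> \<tau>" and "\<tau> \<le> 1"
    and "is_pcd_direction \<tau> g1 g2 g3 d"
    and "pcd_constraints_active \<tau> g2 g3 d"
  shows "(\<exists>\<mu>. is_pcd_multiplier g1 g2 g3 d \<mu>) \<and>
    (\<forall>\<mu>. is_pcd_multiplier g1 g2 g3 d \<mu> \<longrightarrow>
       gram_matrix g2 g3 *v \<mu> = gram_rhs \<tau> g1 g2 g3) \<and>
    (g2 \<noteq> 0 \<longrightarrow> g3 \<noteq> 0 \<longrightarrow>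
       gram_delta g2 g3 = (norm g2)\<^sup>2 * (norm g3)\<^sup>2 * (sin (vec_angle g2 g3))\<^sup>2) \<and>
    ((\<exists>!\<mu>. gram_matrix g2 g3 *v \<mu> = gram_rhs \<tau> g1 g2 g3) \<longleftrightarrow>
       \<not> collinear_vectors g2 g3) \<and>
    (\<not> collinear_vectors g2 g3 \<longrightarrow>
       gram_delta g2 g3 \<noteq> 0 \<and>
       (\<forall>\<mu>. gram_matrix g2 g3 *v \<mu> = gram_rhs \<tau> g1 g2 g3 \<longrightarrow>
          \<mu> $ 1 = ((norm g3)\<^sup>2 * (\<tau> * (norm g2)\<^sup>2 - g2 \<bullet> g1)
                   - (g2 \<bullet> g3) * (\<tau> * (norm g3)\<^sup>2 - g3 \<bullet> g1)) / gram_delta g2 g3 \<and>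
          \<mu> $ 2 = ((norm g2)\<^sup>2 * (\<tau> * (norm g3)\<^sup>2 - g3 \<bullet> g1)
                   - (g2 \<bullet> g3) * (\<tau> * (norm g2)\<^sup>2 - g2 \<bullet> g1)) / gram_delta g2 g3))"
proof (intro conjI impI allI)
  show "\<exists>\<mu>. is_pcd_multiplier g1 g2 g3 d \<mu>"
    using assms(3,4) by (rule pcd_multiplier_exists)
next
  fix \<mu> assume "is_pcd_multiplier g1 g2 g3 d \<mu>"
  with assms(4) show "gram_matrix g2 g3 *v \<mu> = gram_rhs \<tau> g1 g2 g3"
    by (rule pcd_multiplier_gram)
next
  assume "g2 \<noteq> 0" "g3 \<noteq> 0"
  then show "gram_delta g2 g3 = (norm g2)\<^sup>2 * (norm g3)\<^sup>2 * (sin (vec_angle g2 g3))\<^sup>2"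
    by (rule gram_delta_eq_sin_angle)
next
  show "(\<exists>!\<mu>. gram_matrix g2 g3 *v \<mu> = gram_rhs \<tau> g1 g2 g3) \<longleftrightarrow> \<not> collinear_vectors g2 g3"
  proof
    assume "\<not> collinear_vectors g2 g3"
    then have delta: "gram_delta g2 g3 \<noteq> 0"
      using collinear_if_gram_delta_eq_0 by blast
    show "\<exists>!\<mu>. gram_matrix g2 g3 *v \<mu> = gram_rhs \<tau> g1 g2 g3"
      by (simp add: gram_rhs_def gram_solution[OF delta])
  qed (rule gram_unique_imp_not_collinear)
next
  assume "\<not> collinear_vectors g2 g3"
  then show delta: "gram_delta g2 g3 \<noteq> 0"
    using collinear_if_gram_delta_eq_0 by blast
  fix \<mu> assume "gram_matrix g2 g3 *v \<mu> = gram_rhs \<tau> g1 g2 g3"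
  then have \<mu>: "\<mu> = vector
      [((norm g3)\<^sup>2 * (\<tau> * (norm g2)\<^sup>2 - g2 \<bullet> g1) - (g2 \<bullet> g3) * (\<tau> * (norm g3)\<^sup>2 - g3 \<bullet> g1)) / gram_delta g2 g3,
       ((norm g2)\<^sup>2 * (\<tau> * (norm g3)\<^sup>2 - g3 \<bullet> g1) - (g2 \<bullet> g3) * (\<tau> * (norm g2)\<^sup>2 - g2 \<bullet> g1)) / gram_delta g2 g3]"
    by (simp only: gram_rhs_def gram_solution[OF delta])
  show "\<mu> $ 1 = ((norm g3)\<^sup>2 * (\<tau> * (norm g2)\<^sup>2 - g2 \<bullet> g1)
                   - (g2 \<bullet> g3) * (\<tau> * (norm g3)\<^sup>2 - g3 \<bullet> g1)) / gram_delta g2 g3"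
    unfolding \<mu> by (rule vector_2)
  show "\<mu> $ 2 = ((norm g2)\<^sup>2 * (\<tau> * (norm g3)\<^sup>2 - g3 \<bullet> g1)
                   - (g2 \<bullet> g3) * (\<tau> * (norm g2)\<^sup>2 - g2 \<bullet> g1)) / gram_delta g2 g3"
    unfolding \<mu> by (rule vector_2)
qed

end
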